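(* Let $x,y,z,q$ be complex numbers with $|q|<1$, $y\neq q^{-n}$ and $y\neq xzq^{n}$ for every integer $n\ge 0$. Define $$\phi(x,y,z,q):=\sum_{n=0}^{\infty}\frac{x^{n}q^{n(n+1)/2}(-z;q)_{n}}{(y;q)_{n+1}(q;q)_{n}},$$ and for each positive integer $m$ define $$e_m(x,y,z,q):=\sum_{n\ge 0}x^{n}q^{n(n+1)/2}\sum_{j\ge 0}\begin{bmatrix} n+j\\ j\end{bmatrix}y^{j}\sum_{l\ge 0}\begin{bmatrix} m-1-j-l\\ n\end{bmatrix}q^{l(l-1)/2}z^{l}\begin{bmatrix} n\\ l\end{bmatrix}.$$ Then for every integer $m\ge 2$, $$\phi(xq^m,y,z,q)=\frac{e_m(x,y,z,q)\,\phi(xq,y,z,q)-e_{m-1}(xq,y,z,q)\,\phi(x,y,z,q)}{\prod_{j=1}^{m-1}(y-xzq^{j})}.$$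
   Context: $(a;q)_n=\prod_{k=0}^{n-1}(1-aq^k)$ for $n\ge 0$, $(a;q)_\infty=\prod_{k\ge0}(1-aq^k)$. The Gaussian polynomial $\begin{bmatrix} N\\ M\end{bmatrix}=\begin{bmatrix} N\\ M\end{bmatrix}_q$ equals $\frac{(q;q)_N}{(q;q)_M(q;q)_{N-M}}$ if $0\le M\le N$ and $0$ otherwise (in particular it is $0$ when $N<0$). All summation indices range over nonnegative integers. *)

theory Defs
  imports "HOL-Analysis.Analysis"
begin

definition qpoch :: "complex \<Rightarrow> complex \<Rightarrow> nat \<Rightarrow> complex" where
  "qpoch a q n = (\<Prod>k<n. 1 - a * q ^ k)"

text \<open>The arguments are integers because the upper one can be negative, in which case the value is 0.\<close>

definition gauss_poly :: "complex \<Rightarrow> int \<Rightarrow> int \<Rightarrow> complex" where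
  "gauss_poly q N M =
     (if 0 \<le> M \<and> M \<le> N
      then qpoch q q (nat N) / (qpoch q q (nat M) * qpoch q q (nat (N - M)))
      else 0)"

definition phi :: "complex \<Rightarrow> complex \<Rightarrow> complex \<Rightarrow> complex \<Rightarrow> complex" where
  "phi x y z q =
     (\<Sum>n. x ^ n * q ^ (n * (n + 1) div 2) * qpoch (- z) q n / (qpoch y q (n + 1) * qpoch q q n))"

text \<open>For fixed \<open>m\<close> only finitely many triples \<open>(n, j, l)\<close> contribute to the following sums.\<close>

definition e_sum :: "nat \<Rightarrow> complex \<Rightarrow> complex \<Rightarrow> complex \<Rightarrow> complex \<Rightarrow> complex" where
  "e_sum m x y z q =
     (\<Sum>n. x ^ n * q ^ (n * (n + 1) div 2) *
       (\<Sum>j. gauss_poly q (int (n + j)) (int j) * y ^ j *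
         (\<Sum>l. gauss_poly q (int m - 1 - int j - int l) (int n) *
            q ^ (l * (l - 1) div 2) * z ^ l * gauss_poly q (int n) (int l))))"

end

theory Submission
  imports Defs "HOL-Computational_Algebra.Formal_Power_Series"
begin

text \<open>
  Comparing consecutive terms of the series shows that \<open>\<phi>\<close> satisfies the \<open>q\<close>-difference equation
  \<open>(y - xzq) \<phi>(xq\<^sup>2) = (1 + y + xq) \<phi>(xq) - \<phi>(x)\<close>, so it suffices that \<open>e\<^sub>m(x)\<close> obeys the matching
  three-term recurrence \<open>e\<^sub>m\<^sub>+\<^sub>2 = (1 + y + xq\<^bsup>m+1\<^esup>) e\<^sub>m\<^sub>+\<^sub>1 - (y - xzq\<^sup>m) e\<^sub>m\<close> with \<open>e\<^sub>0 = 0\<close> and \<open>e\<^sub>1 = 1\<close>.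
  The generating function in \<open>t\<close> of the sequence \<open>e\<^sub>m\<^sub>+\<^sub>1\<close> is the sum over \<open>n\<close> of
  \<open>F\<^sub>n(t) = x\<^sup>n q\<^bsup>n(n+1)/2\<^esup> t\<^sup>n (-zt; q)\<^sub>n / ((t; q)\<^sub>n\<^sub>+\<^sub>1 (yt; q)\<^sub>n\<^sub>+\<^sub>1)\<close>, and the recurrence is read off from
  \<open>(1 - t) (1 - yt) F\<^sub>n\<^sub>+\<^sub>1(t) = xqt (1 + zt) F\<^sub>n(qt)\<close>.
\<close>

unbundle no vec_syntax
unbundle fps_syntax

section \<open>Shifted factorials and their nonvanishing\<close>

lemma qpoch_0 [simp]: "qpoch a q 0 = 1"
  by (simp add: qpoch_def)

lemma qpoch_Suc: "qpoch a q (Suc n) = qpoch a q n * (1 - a * q ^ n)"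
  by (simp add: qpoch_def)

lemma qpoch_nonzero:
  assumes "\<And>k. a * q ^ k \<noteq> 1"
  shows "qpoch a q n \<noteq> 0"
  using assms by (simp add: qpoch_def)

lemma power_Suc_neq_1_if_norm_less_1:
  fixes q :: complex
  assumes "norm q < 1"
  shows "q * q ^ k \<noteq> 1"
proof
  assume "q * q ^ k = 1"
  then have "norm q ^ Suc k = 1"
    by (metis norm_one norm_power power_Suc)
  moreover have "norm q ^ Suc k < 1"
    using assms power_Suc_less_one[of "norm q" k] by (cases "q = 0") auto
  ultimately show False by simp
qed

lemma qpoch_q_q_nonzero:
  "norm q < 1 \<Longrightarrow> qpoch q q n \<noteq> 0"
  by (rule qpoch_nonzero) (rule power_Suc_neq_1_if_norm_less_1)

lemma triangular_Suc: "Suc n * (Suc n + 1) div 2 = n * (n + 1) div 2 + Suc n"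
  by simp

section \<open>Gaussian polynomials and their generating functions\<close>

lemma gauss_poly_nat:
  "gauss_poly q (int n) (int k) =
     (if k \<le> n then qpoch q q n / (qpoch q q k * qpoch q q (n - k)) else 0)"
  by (simp add: gauss_poly_def nat_diff_distrib flip: of_nat_diff)

lemma gauss_poly_0_right:
  "norm q < 1 \<Longrightarrow> gauss_poly q (int n) 0 = 1"
  using gauss_poly_nat[of q n 0] qpoch_q_q_nonzero[of q n] by simp

lemma gauss_poly_symmetric:
  "gauss_poly q (int (n + k)) (int k) = gauss_poly q (int (n + k)) (int n)"
  unfolding gauss_poly_nat by (simp add: mult.commute)

text \<open>The q-Pascal rule. For \<open>k < n\<close>, a common denominator reduces it to
  \<open>b * (1 - c) + (1 - b) = 1 - b * c\<close> with \<open>b = q ^ (k + 1)\<close> and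
  \<open>c = q ^ (n - k)\<close>.\<close>

lemma gauss_poly_Suc_Suc:
  assumes "norm q < 1"
  shows "gauss_poly q (int (Suc n)) (int (Suc k)) =
    q ^ Suc k * gauss_poly q (int n) (int (Suc k)) + gauss_poly q (int n) (int k)"
proof -
  note nz = qpoch_q_q_nonzero[OF assms]
  consider "n < k" | "n = k" | "k < n" by linarith
  then show ?thesis
  proof cases
    case 3
    then obtain d where d: "n = Suc (k + d)" using less_iff_Suc_add by auto
    define A B C where "A = qpoch q q n" and "B = qpoch q q k" and "C = qpoch q q d"
    define b c where "b = q * q ^ k" and "c = q * q ^ d"
    have nz': "A \<noteq> 0" "B \<noteq> 0" "C \<noteq> 0" "1 - b \<noteq> 0" "1 - c \<noteq> 0"
      using nz power_Suc_neq_1_if_norm_less_1[OF assms]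
      by (auto simp: A_def B_def C_def b_def c_def)
    have 1: "gauss_poly q (int (Suc n)) (int (Suc k)) = A * (1 - b * c) / (B * (1 - b) * (C * (1 - c)))"
      unfolding gauss_poly_nat A_def B_def C_def b_def c_def
      by (simp add: d qpoch_Suc power_add mult_ac)
    have 2: "gauss_poly q (int n) (int (Suc k)) = A / (B * (1 - b) * C)"
      unfolding gauss_poly_nat A_def B_def C_def b_def c_def
      by (simp add: d qpoch_Suc)
    have 3: "gauss_poly q (int n) (int k) = A / (B * (C * (1 - c)))"
      unfolding gauss_poly_nat A_def B_def C_def b_def c_def
      by (simp add: d Suc_diff_le qpoch_Suc)
    have "A * (1 - b * c) / (B * (1 - b) * (C * (1 - c))) = b * (A / (B * (1 - b) * C)) + A / (B * (C * (1 - c)))"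
      using nz' by (simp add: divide_simps) (simp add: algebra_simps)
    then show ?thesis unfolding 1 2 3 by (simp add: b_def)
  qed (use nz in \<open>simp_all add: gauss_poly_nat del: of_nat_Suc\<close>)
qed

text \<open>For \<open>norm q < 1\<close> this is the expansion of 1/(t;q)_{n+1}, by the q-binomial
  theorem.\<close>

definition gauss_fps :: "complex \<Rightarrow> nat \<Rightarrow> complex fps" where
  "gauss_fps q n = Abs_fps (\<lambda>j. gauss_poly q (int (n + j)) (int j))"

text \<open>For \<open>norm q < 1\<close> this is the polynomial (-zt;q)_n, expanded by the finite
  q-binomial theorem.\<close>

definition gauss_row_fps :: "complex \<Rightarrow> complex \<Rightarrow> nat \<Rightarrow> complex fps" where
  "gauss_row_fps q z n =
     Abs_fps (\<lambda>l. q ^ (l * (l - 1) div 2) * z ^ l * gauss_poly q (int n) (int l))"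

abbreviation fps_dilate :: "complex \<Rightarrow> complex fps \<Rightarrow> complex fps" where
  "fps_dilate c f \<equiv> f oo (fps_const c * fps_X)"

lemma fps_dilate_nth: "fps_dilate c f $ n = c ^ n * f $ n"
  by (simp add: fps_compose_linear)

lemma gauss_fps_0:
  assumes "norm q < 1"
  shows "(1 - fps_X) * gauss_fps q 0 = 1"
proof (rule fps_ext)
  fix n
  have "gauss_poly q (int k) (int k) = 1" for k
    using qpoch_q_q_nonzero[OF assms] by (simp add: gauss_poly_nat)
  then show "((1 - fps_X) * gauss_fps q 0) $ n = 1 $ n"
    by (cases n) (simp_all add: gauss_fps_def left_diff_distrib)
qed

text \<open>Mirrors (t;q)_{n+2} = (1-t)(qt;q)_{n+1}; at each positive degree it is one instance of
  the q-Pascal rule.\<close>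

lemma gauss_fps_Suc:
  assumes "norm q < 1"
  shows "(1 - fps_X) * gauss_fps q (Suc n) = fps_dilate q (gauss_fps q n)"
proof (rule fps_ext)
  fix j
  show "((1 - fps_X) * gauss_fps q (Suc n)) $ j = fps_dilate q (gauss_fps q n) $ j"
  proof (cases j)
    case 0
    then show ?thesis
      using gauss_poly_0_right[OF assms, of n] gauss_poly_0_right[OF assms, of "Suc n"]
      by (simp add: gauss_fps_def left_diff_distrib fps_dilate_nth)
  next
    case (Suc i)
    then show ?thesis
      using gauss_poly_Suc_Suc[OF assms, of "n + Suc i" i]
      by (simp add: gauss_fps_def left_diff_distrib fps_dilate_nth add_ac)
  qed
qed

lemma fps_dilate_linear: "fps_dilate c (1 - fps_X) = 1 - fps_const c * fps_X"
  by (simp add: fps_compose_sub_distrib)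

lemma fps_dilate_mult: "fps_dilate c (f * g) = fps_dilate c f * fps_dilate c g"
  by (rule fps_compose_mult_distrib) simp

lemma fps_dilate_commute: "fps_dilate c (fps_dilate d f) = fps_dilate d (fps_dilate c f)"
  by (rule fps_ext) (simp add: fps_dilate_nth)

text \<open>Mirrors (-zt;q)_{n+1} = (1+zt)(-zqt;q)_n.\<close>

lemma gauss_row_fps_Suc:
  assumes "norm q < 1"
  shows "gauss_row_fps q z (Suc n) =
    (1 + fps_const z * fps_X) * fps_dilate q (gauss_row_fps q z n)"
proof (rule fps_ext)
  fix l
  show "gauss_row_fps q z (Suc n) $ l =
    ((1 + fps_const z * fps_X) * fps_dilate q (gauss_row_fps q z n)) $ l"
  proof (cases l)
    case 0
    then show ?thesis
      using gauss_poly_0_right[OF assms, of n] gauss_poly_0_right[OF assms, of "Suc n"]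
      by (simp add: gauss_row_fps_def distrib_right mult.assoc fps_dilate_nth)
  next
    case (Suc i)
    \<comment> \<open>The extra \<open>q ^ i\<close> is exactly what the dilation contributes to the
      term shifted by \<open>z * t\<close>.\<close>
    have tri: "Suc i * (Suc i - 1) div 2 = i * (i - 1) div 2 + i"
      by (cases i) simp_all
    show ?thesis
      unfolding Suc distrib_right mult.assoc fps_add_nth fps_mult_left_const_nth mult_1_left
        fps_X_mult_nth fps_dilate_nth
      unfolding gauss_row_fps_def fps_nth_Abs_fps gauss_poly_Suc_Suc[OF assms] tri power_add
      by (simp add: algebra_simps)
  qed
qed

section \<open>The generating function of \<open>e_sum\<close>\<close>

text \<open>The series F_n(t), with each reciprocal replaced by its expansion so that no division of
  power series occurs.\<close>

definition e_fps :: "complex \<Rightarrow> complex \<Rightarrow> complex \<Rightarrow> complex \<Rightarrow> nat \<Rightarrow> complex fps" where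
  "e_fps x y z q n = fps_const (x ^ n * q ^ (n * (n + 1) div 2)) * (fps_X ^ n *
     (fps_dilate y (gauss_fps q n) * (gauss_row_fps q z n * gauss_fps q n)))"

lemma e_fps_0:
  assumes "norm q < 1"
  shows "(1 - fps_X) * (1 - fps_const y * fps_X) * e_fps x y z q 0 = 1"
proof -
  have "gauss_row_fps q z 0 = 1"
    by (rule fps_ext) (simp add: gauss_row_fps_def gauss_poly_def)
  moreover have "(1 - fps_const y * fps_X) * fps_dilate y (gauss_fps q 0) = 1"
    using arg_cong[OF gauss_fps_0[OF assms], of "fps_dilate y"]
    by (simp add: fps_dilate_mult fps_dilate_linear)
  ultimately have "(1 - fps_X) * (1 - fps_const y * fps_X) * e_fps x y z q 0 =
     ((1 - fps_const y * fps_X) * fps_dilate y (gauss_fps q 0)) * ((1 - fps_X) * gauss_fps q 0)"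
    by (simp add: e_fps_def mult_ac)
  then show ?thesis
    by (simp add: gauss_fps_0[OF assms] \<open>(1 - fps_const y * fps_X) * fps_dilate y (gauss_fps q 0) = 1\<close>)
qed

text \<open>Each of the three factors obeys its own recursion, and the prefactor at
  \<open>Suc n\<close> is xqt times the dilated prefactor at \<open>n\<close>.\<close>

lemma e_fps_Suc:
  assumes "norm q < 1"
  shows "(1 - fps_X) * (1 - fps_const y * fps_X) * e_fps x y z q (Suc n) =
    fps_const (x * q) * (fps_X * ((1 + fps_const z * fps_X) * fps_dilate q (e_fps x y z q n)))"
proof -
  have D: "(1 - fps_const y * fps_X) * fps_dilate y (gauss_fps q (Suc n)) =
      fps_dilate q (fps_dilate y (gauss_fps q n))"
    using arg_cong[OF gauss_fps_Suc[OF assms], of "fps_dilate y" n]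
    by (simp add: fps_dilate_mult fps_dilate_linear fps_dilate_commute)
  have const: "fps_dilate q (fps_const c) = fps_const c" for c
    by simp
  have Xn: "fps_dilate q (fps_X ^ n) = fps_const (q ^ n) * fps_X ^ n"
    by (rule fps_ext) (simp add: fps_dilate_nth)
  have "(1 - fps_X) * (1 - fps_const y * fps_X) * e_fps x y z q (Suc n) =
      fps_const (x ^ Suc n * q ^ (Suc n * (Suc n + 1) div 2)) * (fps_X ^ Suc n *
        (((1 - fps_const y * fps_X) * fps_dilate y (gauss_fps q (Suc n))) *
         (gauss_row_fps q z (Suc n) * ((1 - fps_X) * gauss_fps q (Suc n)))))"
    by (simp only: e_fps_def mult_ac)
  also have "\<dots> = fps_const (x * q) * (fps_X * ((1 + fps_const z * fps_X) * fps_dilate q (e_fps x y z q n)))"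
    unfolding D gauss_fps_Suc[OF assms] gauss_row_fps_Suc[OF assms] triangular_Suc
      e_fps_def fps_dilate_mult const Xn
    by (simp only: power_add power_Suc mult_ac flip: fps_const_mult)
  finally show ?thesis .
qed

lemma e_fps_nth_eq_0: "k < n \<Longrightarrow> e_fps x y z q n $ k = 0"
  by (simp add: e_fps_def fps_X_power_mult_nth)

text \<open>The factor t^n leaves degree \<open>M - n\<close>, which the Cauchy product splits among
  the three series; \<open>M\<close> plays the part of m-1.\<close>

lemma e_fps_nth:
  "e_fps x y z q n $ M = x ^ n * q ^ (n * (n + 1) div 2) *
     (\<Sum>j. gauss_poly q (int (n + j)) (int j) * y ^ j *
       (\<Sum>l. gauss_poly q (int M - int j - int l) (int n) *
          q ^ (l * (l - 1) div 2) * z ^ l * gauss_poly q (int n) (int l)))"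
proof -
  define a where "a j l = gauss_poly q (int M - int j - int l) (int n) *
          q ^ (l * (l - 1) div 2) * z ^ l * gauss_poly q (int n) (int l)" for j l
  have a0: "a j l = 0" if "M < n + j + l" for j l
    using that by (simp add: a_def gauss_poly_def)
  have inner: "(\<Sum>l. a j l) = (\<Sum>l\<le>M - n - j. a j l)" for j
  proof (cases "n + j \<le> M")
    case True
    then show ?thesis
      by (intro suminf_finite) (auto intro!: a0)
  next
    case False
    \<comment> \<open>Here \<open>M - n - j\<close> truncates to 0, so the finite sum keeps the term
      \<open>l = 0\<close>, which vanishes too.\<close>
    then show ?thesis by (simp add: a0)
  qed
  show ?thesis
  proof (cases "n \<le> M")
    case False
    then show ?thesis
      unfolding a_def[symmetric] by (simp add: e_fps_nth_eq_0 a0)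
  next
    case True
    have nth: "(gauss_row_fps q z n * gauss_fps q n) $ (M - n - j) = (\<Sum>l\<le>M - n - j. a j l)"
      if "j \<le> M - n" for j
      unfolding fps_mult_nth atLeast0AtMost
    proof (rule sum.cong)
      fix l assume l: "l \<in> {..M - n - j}"
      \<comment> \<open>The degree left for the third factor; symmetry then turns its coefficient
        into one with lower argument \<open>n\<close>.\<close>
      define k where "k = M - n - j - l"
      have "int M - int j - int l = int (n + k)"
        using l that True by (simp add: k_def)
      then show "gauss_row_fps q z n $ l * gauss_fps q n $ (M - n - j - l) = a j l"
        unfolding a_def gauss_row_fps_def gauss_fps_def fps_nth_Abs_fps k_def[symmetric]
        by (simp only: gauss_poly_symmetric[of q n k] mult_ac)
    qed simp
    have "(\<Sum>j. gauss_poly q (int (n + j)) (int j) * y ^ j * (\<Sum>l. a j l)) =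
      (\<Sum>j\<le>M - n. gauss_poly q (int (n + j)) (int j) * y ^ j * (\<Sum>l. a j l))"
      using True by (intro suminf_finite) (auto simp: a0)
    also have "\<dots> = (fps_dilate y (gauss_fps q n) * (gauss_row_fps q z n * gauss_fps q n)) $ (M - n)"
      unfolding fps_mult_nth[of "fps_dilate y _"] atLeast0AtMost
    proof (rule sum.cong)
      fix j assume "j \<in> {..M - n}"
      then show "gauss_poly q (int (n + j)) (int j) * y ^ j * (\<Sum>l. a j l) =
          fps_dilate y (gauss_fps q n) $ j * (gauss_row_fps q z n * gauss_fps q n) $ (M - n - j)"
        by (simp only: inner nth fps_dilate_nth atMost_iff) (simp add: gauss_fps_def)
    qed simp
    finally show ?thesis
      unfolding a_def[symmetric] using True by (simp add: e_fps_def fps_X_power_mult_nth)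
  qed
qed

section \<open>The three-term recurrence of \<open>e_sum\<close>\<close>

lemma e_sum_0: "e_sum 0 x y z q = 0"
  by (simp add: e_sum_def gauss_poly_def)

text \<open>The factor t^n kills all terms with \<open>n > M\<close>. The free cutoff
  \<open>K\<close> lets sums for different \<open>M\<close> share one range.\<close>

lemma e_sum_Suc:
  assumes "M < K"
  shows "e_sum (Suc M) x y z q = (\<Sum>n<K. e_fps x y z q n $ M)"
proof -
  have "e_sum (Suc M) x y z q = (\<Sum>n. e_fps x y z q n $ M)"
    by (simp add: e_sum_def e_fps_nth)
  also have "\<dots> = (\<Sum>n<K. e_fps x y z q n $ M)"
    using assms by (intro suminf_finite) (auto intro: e_fps_nth_eq_0)
  finally show ?thesis .
qed

lemma one_minus_times_one_minus_nth:
  fixes f :: "complex fps"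
  shows "((1 - fps_X) * (1 - fps_const y * fps_X) * f) $ 0 = f $ 0"
    and "((1 - fps_X) * (1 - fps_const y * fps_X) * f) $ (Suc 0) = f $ (Suc 0) - (1 + y) * f $ 0"
    and "((1 - fps_X) * (1 - fps_const y * fps_X) * f) $ (Suc (Suc M)) =
      f $ (Suc (Suc M)) - (1 + y) * f $ (Suc M) + y * f $ M"
  by (simp_all add: left_diff_distrib mult.assoc algebra_simps)

lemma e_sum_1:
  assumes "norm q < 1"
  shows "e_sum (Suc 0) x y z q = 1"
  using arg_cong[OF e_fps_0[OF assms], of "\<lambda>f. f $ 0" y x z]
  by (simp add: e_sum_Suc[where K = 1] one_minus_times_one_minus_nth)

text \<open>Compare coefficients of t^{m+1} in \<open>e_fps_0\<close> and \<open>e_fps_Suc\<close>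
  and sum over \<open>n\<close>. The case \<open>m = 0\<close> is separate because
  \<open>e_sum 0\<close> is not a coefficient of the generating function.\<close>

lemma e_sum_rec:
  assumes "norm q < 1"
  shows "e_sum (Suc (Suc m)) x y z q =
    (1 + y + x * q ^ Suc m) * e_sum (Suc m) x y z q - (y - x * z * q ^ m) * e_sum m x y z q"
proof -
  let ?f = "\<lambda>n k. e_fps x y z q n $ k"
  show ?thesis
  proof (cases m)
    case 0
    have "?f 0 0 = 1" "?f 0 1 = (1 + y) * ?f 0 0"
      using arg_cong[OF e_fps_0[OF assms], of "\<lambda>f. f $ 0" y x z]
        arg_cong[OF e_fps_0[OF assms], of "\<lambda>f. f $ 1" y x z]
      by (simp_all only: One_nat_def one_minus_times_one_minus_nth) simp_all
    moreover have "?f 1 1 = x * q * ?f 0 0"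
      using arg_cong[OF e_fps_Suc[OF assms], of "\<lambda>f. f $ 1" y x z 0]
      by (simp add: one_minus_times_one_minus_nth e_fps_nth_eq_0 distrib_right mult.assoc fps_dilate_nth)
    moreover have "e_sum (Suc (Suc m)) x y z q = ?f 0 1 + ?f 1 1"
      using 0 by (simp add: e_sum_Suc[where K = 2] numeral_2_eq_2)
    ultimately show ?thesis
      using 0 by (simp add: e_sum_0 e_sum_1[OF assms] algebra_simps)
  next
    case (Suc M)
    have 0: "?f 0 (Suc (Suc M)) = (1 + y) * ?f 0 (Suc M) - y * ?f 0 M"
      using arg_cong[OF e_fps_0[OF assms], of "\<lambda>f. f $ (Suc (Suc M))" y x z]
      by (simp add: one_minus_times_one_minus_nth algebra_simps)
    have S: "?f (Suc n) (Suc (Suc M)) = (1 + y) * ?f (Suc n) (Suc M) - y * ?f (Suc n) M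
        + (x * q ^ Suc (Suc M) * ?f n (Suc M) + x * z * q ^ Suc M * ?f n M)" for n
      using arg_cong[OF e_fps_Suc[OF assms], of "\<lambda>f. f $ (Suc (Suc M))" y x z n]
      by (simp add: one_minus_times_one_minus_nth distrib_right mult.assoc fps_dilate_nth)
         (simp add: algebra_simps)
    let ?K = "Suc (Suc M)"
    \<comment> \<open>The left side of the functional equation runs over \<open>Suc n\<close> and
      the right side over \<open>n\<close>, so \<open>e_sum\<close> is needed both with the term 0
      split off and as a plain sum.\<close>
    have E: "e_sum (Suc k) x y z q = ?f 0 k + (\<Sum>n<?K. ?f (Suc n) k)" if "k \<le> ?K" for k
      using that by (simp add: e_sum_Suc[where K = "Suc ?K"] sum.lessThan_Suc_shift del: sum.lessThan_Suc)
    have E': "e_sum (Suc k) x y z q = (\<Sum>n<?K. ?f n k)" if "k < ?K" for k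
      using that by (rule e_sum_Suc)
    have "e_sum (Suc ?K) x y z q = (1 + y) * (?f 0 (Suc M) + (\<Sum>n<?K. ?f (Suc n) (Suc M)))
       - y * (?f 0 M + (\<Sum>n<?K. ?f (Suc n) M))
       + (x * q ^ ?K * (\<Sum>n<?K. ?f n (Suc M)) + x * z * q ^ Suc M * (\<Sum>n<?K. ?f n M))"
      unfolding E[OF order.refl] 0 S sum.distrib sum_subtractf sum_distrib_left[symmetric]
      by (simp only: algebra_simps)
    also have "\<dots> = (1 + y) * e_sum ?K x y z q - y * e_sum (Suc M) x y z q
       + (x * q ^ ?K * e_sum ?K x y z q + x * z * q ^ Suc M * e_sum (Suc M) x y z q)"
      by (simp only: E[of "Suc M"] E[of M] E'[of "Suc M", symmetric] E'[of M, symmetric] le_SucI order.refl lessI less_SucI)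
    finally show ?thesis
      unfolding Suc by (simp only: algebra_simps)
  qed
qed

section \<open>The \<open>q\<close>-difference equation of \<open>phi\<close>\<close>

definition phi_term :: "complex \<Rightarrow> complex \<Rightarrow> complex \<Rightarrow> complex \<Rightarrow> nat \<Rightarrow> complex" where
  "phi_term x y z q n =
     x ^ n * q ^ (n * (n + 1) div 2) * qpoch (- z) q n / (qpoch y q (n + 1) * qpoch q q n)"

text \<open>Hence the values of \<open>phi\<close> at x, xq and xq^2 sum the same terms with weights
  1, q^n and q^{2n}.\<close>

lemma phi_term_dilate: "phi_term (x * q ^ k) y z q n = (q ^ k) ^ n * phi_term x y z q n"
  by (simp add: phi_term_def power_mult_distrib)

lemma phi_term_Suc:
  assumes "norm q < 1" and "\<And>n. y * q ^ n \<noteq> 1"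
  shows "(1 - q ^ Suc n) * (1 - y * q ^ Suc n) * phi_term x y z q (Suc n) =
    x * q ^ Suc n * (1 + z * q ^ n) * phi_term x y z q n"
proof -
  have "1 - q ^ Suc n \<noteq> 0" "1 - y * q ^ Suc n \<noteq> 0"
    using power_Suc_neq_1_if_norm_less_1[OF assms(1), of n] assms(2)[of "Suc n"] by auto
  moreover have "qpoch y q (Suc n) \<noteq> 0" "qpoch q q n \<noteq> 0"
    using qpoch_nonzero[OF assms(2)] qpoch_q_q_nonzero[OF assms(1)] by auto
  moreover have "phi_term x y z q (Suc n) =
      (x * x ^ n) * (q ^ (n * (n + 1) div 2) * q ^ Suc n) * (qpoch (- z) q n * (1 + z * q ^ n)) /
      (qpoch y q (Suc n) * (1 - y * q ^ Suc n) * (qpoch q q n * (1 - q ^ Suc n)))"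
    unfolding phi_term_def triangular_Suc
    unfolding power_add Suc_eq_plus1[symmetric] qpoch_Suc[of _ _ n] qpoch_Suc[of y q "Suc n"]
    by (simp only: power_Suc mult_minus_left diff_minus_eq_add)
  moreover have "phi_term x y z q n =
      x ^ n * q ^ (n * (n + 1) div 2) * qpoch (- z) q n / (qpoch y q (Suc n) * qpoch q q n)"
    by (simp add: phi_term_def)
  ultimately show ?thesis
    by (simp only: times_divide_eq_right times_divide_eq_left frac_eq_eq no_zero_divisors
        not_False_eq_True mult_ac)
qed

lemma summable_phi_term:
  assumes "norm q < 1" and "\<And>n. y * q ^ n \<noteq> 1"
  shows "summable (phi_term x y z q)"
proof -
  \<comment> \<open>The ratio of consecutive terms; its factor \<open>q ^ Suc n\<close> drives it to
    0.\<close>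
  define r where "r n = x * q ^ Suc n * (1 + z * q ^ n) / ((1 - q ^ Suc n) * (1 - y * q ^ Suc n))" for n
  have q0: "(\<lambda>n. q ^ n) \<longlonglongrightarrow> 0"
    using assms(1) by (rule LIMSEQ_power_zero)
  have q1: "(\<lambda>n. q ^ Suc n) \<longlonglongrightarrow> 0"
    using q0 by (rule LIMSEQ_Suc)
  have "r \<longlonglongrightarrow> x * 0 * (1 + z * 0) / ((1 - 0) * (1 - y * 0))"
    unfolding r_def by (intro tendsto_intros q0 q1) simp
  then have "r \<longlonglongrightarrow> 0" by simp
  then have "\<forall>\<^sub>F n in sequentially. norm (r n) < 1 / 2"
    using tendstoD[of r 0 sequentially "1/2"] by simp
  then obtain N where N: "\<And>n. n \<ge> N \<Longrightarrow> norm (r n) < 1 / 2"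
    by (auto simp: eventually_sequentially)
  have rec: "phi_term x y z q (Suc n) = r n * phi_term x y z q n" for n
  proof -
    have "1 - q ^ Suc n \<noteq> 0" "1 - y * q ^ Suc n \<noteq> 0"
      using power_Suc_neq_1_if_norm_less_1[OF assms(1), of n] assms(2)[of "Suc n"] by auto
    then show ?thesis
      using phi_term_Suc[OF assms, of n x z]
      by (simp add: r_def nonzero_eq_divide_eq mult.commute del: power_Suc)
  qed
  show ?thesis
  proof (rule summable_ratio_test[of "1/2" N])
    fix n assume "N \<le> n"
    then show "norm (phi_term x y z q (Suc n)) \<le> 1 / 2 * norm (phi_term x y z q n)"
      using N[of n] unfolding rec norm_mult by (intro mult_right_mono) auto
  qed simp
qed

lemma phi_q_difference:
  assumes "norm q < 1" and "\<And>n. y * q ^ n \<noteq> 1"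
  shows "(y - x * z * q) * phi (x * q ^ 2) y z q =
    (1 + y + x * q) * phi (x * q) y z q - phi x y z q"
proof -
  define T where "T = phi_term x y z q"
  define p where "p k = phi (x * q ^ k) y z q" for k
  have S: "(\<lambda>n. (q ^ k) ^ n * T n) sums p k" for k
    using summable_sums[OF summable_phi_term[OF assms, of "x * q ^ k" z]]
    unfolding p_def phi_def T_def phi_term_def[symmetric] phi_term_dilate[symmetric] .
  \<comment> \<open>Expanding the weight to 1 - (1+y)q^n + yq^{2n} sums \<open>g\<close> in terms of
    \<open>phi\<close>. Since \<open>g 0 = 0\<close>, the sum also equals that of
    \<open>g (Suc n)\<close>, which \<open>phi_term_Suc\<close> evaluates in a second way.\<close>
  define g where "g n = (1 - q ^ n) * (1 - y * q ^ n) * T n" for n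
  have "(\<lambda>n. (q ^ 0) ^ n * T n - (1 + y) * ((q ^ 1) ^ n * T n) + y * ((q ^ 2) ^ n * T n))
      sums (p 0 - (1 + y) * p 1 + y * p 2)"
    by (intro sums_add sums_diff sums_mult S)
  also have "(\<lambda>n. (q ^ 0) ^ n * T n - (1 + y) * ((q ^ 1) ^ n * T n) + y * ((q ^ 2) ^ n * T n)) = g"
    by (rule ext) (simp add: g_def algebra_simps power2_eq_square power_mult_distrib)
  finally have "g sums (p 0 - (1 + y) * p 1 + y * p 2)" .
  then have 1: "(\<lambda>n. g (Suc n)) sums (p 0 - (1 + y) * p 1 + y * p 2)"
    by (subst sums_Suc_iff) (simp add: g_def)
  have "(\<lambda>n. x * q * ((q ^ 1) ^ n * T n) + x * q * z * ((q ^ 2) ^ n * T n))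
      sums (x * q * p 1 + x * q * z * p 2)"
    by (intro sums_add sums_mult S)
  also have "(\<lambda>n. x * q * ((q ^ 1) ^ n * T n) + x * q * z * ((q ^ 2) ^ n * T n)) = (\<lambda>n. g (Suc n))"
    unfolding g_def T_def phi_term_Suc[OF assms]
    by (rule ext) (simp add: algebra_simps power2_eq_square power_mult_distrib)
  finally have "p 0 - (1 + y) * p 1 + y * p 2 = x * q * p 1 + x * q * z * p 2"
    using 1 sums_unique2 by blast
  then have "(y - x * z * q) * p 2 = (1 + y + x * q) * p 1 - p 0"
    by (simp add: algebra_simps)
  then show ?thesis by (simp add: p_def)
qed

text \<open>Once multiplied by the product, both sides satisfy the same three-term recurrence in
  \<open>m\<close>, so two initial values suffice. The index is one below that of the final
  formula.\<close>

lemma phi_iterated: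
  assumes "norm q < 1" and "\<And>n. y * q ^ n \<noteq> 1"
  shows "(\<Prod>j=1..m. y - x * z * q ^ j) * phi (x * q ^ Suc m) y z q =
    e_sum (Suc m) x y z q * phi (x * q) y z q - e_sum m (x * q) y z q * phi x y z q"
proof (induction m rule: induct_nat_012)
  case 0
  show ?case by (simp add: e_sum_0 e_sum_1[OF assms(1)])
next
  case 1
  show ?case
    using phi_q_difference[OF assms, of x z] e_sum_rec[OF assms(1), of 0 x y z]
    by (simp add: e_sum_0 e_sum_1[OF assms(1)] numeral_2_eq_2)
next
  case (ge2 m)
  define P where "P = (\<Prod>j=1..m. y - x * z * q ^ j)"
  define c d where "c = y - x * z * q ^ Suc m" and "d = y - x * z * q ^ Suc (Suc m)"
  define b where "b = 1 + y + x * q ^ Suc (Suc m)"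
  define p where "p k = phi (x * q ^ k) y z q" for k
  have P1: "(\<Prod>j=1..Suc m. y - x * z * q ^ j) = P * c"
    and P2: "(\<Prod>j=1..Suc (Suc m). y - x * z * q ^ j) = P * c * d"
    by (simp_all add: P_def c_def d_def)
  have step: "d * p (Suc (Suc (Suc m))) = b * p (Suc (Suc m)) - p (Suc m)"
    using phi_q_difference[OF assms, of "x * q ^ Suc m" z]
    by (simp add: p_def b_def d_def power2_eq_square mult_ac)
  have r1: "e_sum (Suc (Suc (Suc m))) x y z q =
      b * e_sum (Suc (Suc m)) x y z q - c * e_sum (Suc m) x y z q"
    unfolding b_def c_def by (rule e_sum_rec[OF assms(1)])
  \<comment> \<open>The index is one lower but the argument carries an extra \<open>q\<close>, so
    the coefficients \<open>b\<close> and \<open>c\<close> agree with those in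
    \<open>r1\<close>.\<close>
  have r2: "e_sum (Suc (Suc m)) (x * q) y z q =
      b * e_sum (Suc m) (x * q) y z q - c * e_sum m (x * q) y z q"
    using e_sum_rec[OF assms(1), of m "x * q" y z] by (simp add: b_def c_def mult_ac)
  have "P * c * d * p (Suc (Suc (Suc m))) = b * (P * c * p (Suc (Suc m))) - c * (P * p (Suc m))"
    by (simp only: mult.assoc step) (simp add: algebra_simps)
  also have "\<dots> = e_sum (Suc (Suc (Suc m))) x y z q * phi (x * q) y z q -
      e_sum (Suc (Suc m)) (x * q) y z q * phi x y z q"
    unfolding r1 r2 ge2[folded p_def, unfolded P1, folded P_def] by (simp add: algebra_simps)
  finally show ?case unfolding P2 p_def .
qed

theorem theorem2p3:
  fixes x y z q :: complex and m :: nat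
  assumes "norm q < 1"
    and "\<And>n::nat. y \<noteq> q powi (- int n)"
    and "\<And>n::nat. y \<noteq> x * z * q ^ n"
    and "m \<ge> 2"
  shows "phi (x * q ^ m) y z q =
    (e_sum m x y z q * phi (x * q) y z q - e_sum (m - 1) (x * q) y z q * phi x y z q)
      / (\<Prod>j=1..m - 1. y - x * z * q ^ j)"
proof -
  have y: "y * q ^ n \<noteq> 1" for n
  proof
    assume "y * q ^ n = 1"
    then have "y = inverse (q ^ n)"
      by (metis inverse_unique mult.commute)
    then show False
      using assms(2)[of n] by (simp add: power_int_minus)
  qed
  have "(\<Prod>j=1..m - 1. y - x * z * q ^ j) \<noteq> 0"
    using assms(3) by auto
  moreover have "Suc (m - 1) = m"
    using assms(4) by simp
  ultimately show ?thesis
    using phi_iterated[OF assms(1) y, of x z "m - 1"] by (simp add: field_simps)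
qed

end
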